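(* For all real $x \ge 3$ and all integers $k \ge 1$, \[ N_k(x) \le 1.35\, k^3 \frac{x \log x}{2^k}, \] where $N_k(x) = \#\{n \le x : \Omega(n) = k\}$.
   Context: $\Omega(n)$ is the number of prime factors of $n$ counted with multiplicity. *)

theory Defs
  imports Complex_Main "HOL-Computational_Algebra.Primes"
begin

definition big_omega :: "nat \<Rightarrow> nat" where
  "big_omega n = size (prime_factorization n)"

definition N :: "nat \<Rightarrow> real \<Rightarrow> nat" where
  "N k x = card {n::nat. 1 \<le> n \<and> real n \<le> x \<and> big_omega n = k}"

end

theory Submission
  imports Defs "HOL-Computational_Algebra.Squarefree" "HOL-Analysis.Harmonic_Numbers"
begin

text \<open>
  Write \<open>n = 2\<^sup>a m\<close> with \<open>m\<close> odd, so that \<open>\<Omega>(m) = k - a\<close>, and bound the number of such \<open>m\<close> by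
  \<open>2\<^bsup>a-k\<^esup> \<Sum>2\<^bsup>\<Omega>(m)\<^esup>\<close> over odd \<open>m \<le> x/2\<^sup>a\<close>. Writing \<open>m = e\<^sup>2s\<close> with \<open>s\<close> squarefree gives
  \<open>2\<^bsup>\<Omega>(m)\<^esup> \<le> 4\<^bsup>\<Omega>(e)\<^esup> \<tau>(s)\<close>. The divisor sum contributes \<open>(1 + log x) x/(2\<^sup>a e\<^sup>2)\<close>, and
  \<open>\<Sum>4\<^bsup>\<Omega>(e)\<^esup>/e\<^sup>2\<close> over odd \<open>e\<close> is at most \<open>3\<close> by its Euler product, which is dominated by the
  telescoping product of \<open>q\<^sup>2/((q-2)(q+2))\<close> over all odd \<open>q \<ge> 3\<close>. Summing over \<open>a \<le> k\<close> yields
  \<open>N\<^sub>k(x) \<le> 3(k+1) x (1 + log x)/2\<^sup>k\<close>, which suffices for \<open>k \<ge> 3\<close>.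
\<close>

section \<open>Additivity of \<open>big_omega\<close> and its comparison with the divisor
  function\<close>

lemma big_omega_mult:
  "a \<noteq> 0 \<Longrightarrow> b \<noteq> 0 \<Longrightarrow> big_omega (a * b) = big_omega a + big_omega b"
  by (simp add: big_omega_def prime_factorization_mult)

lemma big_omega_1 [simp]: "big_omega (Suc 0) = 0"
  by (simp add: big_omega_def)

lemma big_omega_prime [simp]: "prime p \<Longrightarrow> big_omega p = 1"
  by (simp add: big_omega_def prime_factorization_prime)

lemma big_omega_power: "a \<noteq> 0 \<Longrightarrow> big_omega (a ^ j) = j * big_omega a"
  by (induction j) (simp_all add: big_omega_mult)

lemma big_omega_eq_1_imp_prime:
  assumes "big_omega n = 1"
  shows "prime n"
proof -
  obtain p where p: "prime_factorization n = {#p#}"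
    using assms unfolding big_omega_def by (metis One_nat_def size_1_singleton_mset)
  \<comment> \<open>\<open>prime_factorization 0\<close> is the empty multiset, so 0 is
    excluded.\<close>
  have "n \<noteq> 0" using p by (intro notI) simp
  then have "n = p"
    using p prod_mset_prime_factorization[of n] by simp
  moreover have "prime p"
    using p by (metis in_prime_factors_imp_prime set_mset_add_mset_insert insertI1)
  ultimately show ?thesis by simp
qed

text \<open>Products over subsets of the prime factors are pairwise distinct divisors, since
  \<open>prime_factors\<close> recovers the subset; squarefreeness makes \<open>big_omega s\<close>
  the number of distinct primes.\<close>

lemma two_power_big_omega_le_card_divisors:
  assumes "squarefree (s::nat)"
  shows "2 ^ big_omega s \<le> card {d. d dvd s}"
proof -
  have s0: "s \<noteq> 0" using assms by (intro notI) simp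
  have "big_omega s = (\<Sum>p\<in>prime_factors s. 1)"
    unfolding big_omega_def size_multiset_overloaded_eq
    using assms s0
    by (intro sum.cong) (auto simp: count_prime_factorization squarefree_factorial_semiring')
  then have "2 ^ big_omega s = card (Pow (prime_factors s))"
    by (simp add: card_Pow)
  also have "inj_on (\<lambda>A. \<Prod>A) (Pow (prime_factors s))"
  proof (rule inj_on_inverseI[where g = prime_factors])
    fix A assume "A \<in> Pow (prime_factors s)"
    then have A: "A \<subseteq> prime_factors s" by simp
    have "finite A" using A finite_subset by blast
    moreover have "\<And>p. p \<in> A \<Longrightarrow> prime p" using A by auto
    moreover have "0 \<notin> A" using A by auto
    ultimately show "prime_factors (\<Prod>A) = A"
      by (subst prime_factors_prod) (auto simp: prime_prime_factors)
  qed
  then have "card (Pow (prime_factors s)) = card ((\<lambda>A. \<Prod>A) ` Pow (prime_factors s))"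
    by (simp add: card_image)
  also have "\<dots> \<le> card {d. d dvd s}"
  proof (rule card_mono)
    show "finite {d. d dvd s}" using s0 by simp
    have "\<Prod>A dvd s" if "A \<subseteq> prime_factors s" for A
    proof -
      have "\<Prod>A dvd \<Prod>(prime_factors s)" by (rule prod_dvd_prod_subset) (use that in auto)
      also have "\<Prod>(prime_factors s) dvd (\<Prod>p\<in>prime_factors s. p ^ multiplicity p s)"
        by (rule prod_dvd_prod) (auto simp: prime_factors_multiplicity)
      also have "\<dots> = s" using prime_factorization_nat s0 by simp
      finally show ?thesis .
    qed
    then show "(\<lambda>A. \<Prod>A) ` Pow (prime_factors s) \<subseteq> {d. d dvd s}" by auto
  qed
  finally show ?thesis .
qed

section \<open>Harmonic bounds for the divisor sum\<close>

text \<open>Swap the sums: at most n/d of the numbers up to n are multiples of d. The separate bound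
  M keeps one harmonic factor when n is later replaced by various quotients of it.\<close>

lemma sum_card_divisors_le:
  assumes "n \<le> M"
  shows "(\<Sum>s=1..n. real (card {d. d dvd s})) \<le> real n * harm M"
proof -
  have "(\<Sum>s=1..n. real (card {d. d dvd s})) = (\<Sum>s=1..n. \<Sum>d=1..n. if d dvd s then 1 else 0)"
  proof (rule sum.cong[OF refl])
    fix s assume "s \<in> {1..n}"
    then have "{d. d dvd s} = {d\<in>{1..n}. d dvd s}"
      using dvd_imp_le[of _ s] dvd_pos_nat[of s] by (force simp: Suc_le_eq)
    then show "real (card {d. d dvd s}) = (\<Sum>d=1..n. if d dvd s then 1 else 0)"
      by (simp flip: sum.inter_filter)
  qed
  also have "\<dots> = (\<Sum>d=1..n. \<Sum>s=1..n. if d dvd s then 1 else 0)"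
    by (rule sum.swap)
  also have "\<dots> \<le> (\<Sum>d=1..n. real n / real d)"
  proof (rule sum_mono)
    fix d assume d: "d \<in> {1..n}"
    have "{s\<in>{1..n}. d dvd s} \<subseteq> (\<lambda>j. d * j) ` {1..n div d}"
    proof
      fix s assume s: "s \<in> {s\<in>{1..n}. d dvd s}"
      then obtain j where "s = d * j" by auto
      moreover have "j \<le> n div d" using s calculation d
        by (simp add: less_eq_div_iff_mult_less_eq mult.commute)
      moreover have "j \<ge> 1" using s calculation by (cases j) auto
      ultimately show "s \<in> (\<lambda>j. d * j) ` {1..n div d}" by auto
    qed
    then have "card {s\<in>{1..n}. d dvd s} \<le> card {1..n div d}"
      by (rule surj_card_le[rotated]) simp
    then have "card {s\<in>{1..n}. d dvd s} \<le> n div d" by simp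
    then have "real (card {s\<in>{1..n}. d dvd s}) \<le> real n / real d"
      using of_nat_mono of_nat_div_le_of_nat order_trans by blast
    then show "(\<Sum>s=1..n. if d dvd s then 1 else 0) \<le> real n / real d"
      by (simp flip: sum.inter_filter)
  qed
  also have "\<dots> = real n * harm n"
    by (simp add: harm_def sum_distrib_left divide_inverse)
  also have "\<dots> \<le> real n * harm M"
    by (intro mult_left_mono harm_mono assms) auto
  finally show ?thesis .
qed

lemma harm_le_ln_plus_1:
  assumes "n \<ge> 1"
  shows "harm n \<le> ln (real n) + 1"
  using assms
proof (induction n rule: dec_induct)
  case base
  then show ?case by (simp add: harm_def)
next
  case (step m)
  have "ln (real m / real (Suc m)) \<le> real m / real (Suc m) - 1"
    using step by (intro ln_le_minus_one) auto
  then have "ln (real m) - ln (real (Suc m)) \<le> - (1 / real (Suc m))"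
    using step by (simp add: ln_div field_simps)
  then show ?case using step by (simp add: harm_Suc divide_inverse)
qed

section \<open>Euler product bound for the sum over odd square parts\<close>

text \<open>The cutoff Y keeps all sums finite, so the Euler product can be built by induction on q
  without convergence questions.\<close>

definition smooth_odd :: "nat \<Rightarrow> nat \<Rightarrow> nat set" where
  "smooth_odd Y q = {e\<in>{1..Y}. odd e \<and> (\<forall>p. prime p \<longrightarrow> p dvd e \<longrightarrow> p \<le> q)}"

text \<open>The cost of a square part e: \<open>4 ^ big_omega e\<close> is 2 to the power
  \<Omega>(e^2), and 1/e^2 is the proportion of multiples of e^2. It is completely multiplicative on
  nonzero arguments.\<close>

definition wt :: "nat \<Rightarrow> real" where
  "wt e = 4 ^ big_omega e / real e ^ 2"

lemma wt_nonneg: "wt e \<ge> 0"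
  by (simp add: wt_def)

lemma wt_mult: "a \<noteq> 0 \<Longrightarrow> b \<noteq> 0 \<Longrightarrow> wt (a * b) = wt a * wt b"
  by (simp add: wt_def big_omega_mult power_add power_mult_distrib)

lemma finite_smooth_odd [simp]: "finite (smooth_odd Y q)"
  by (simp add: smooth_odd_def)

text \<open>Raising the bound by 2 admits only the new prime 2M+3, because the even number 2M+2
  cannot divide an odd e.\<close>

lemma smooth_odd_step:
  "smooth_odd Y (2 * M + 3) \<subseteq>
     smooth_odd Y (2 * M + 1) \<union> {e \<in> smooth_odd Y (2 * M + 3). prime (2 * M + 3) \<and> (2 * M + 3) dvd e}"
proof
  fix e assume e: "e \<in> smooth_odd Y (2 * M + 3)"
  show "e \<in> smooth_odd Y (2 * M + 1) \<union>
          {e \<in> smooth_odd Y (2 * M + 3). prime (2 * M + 3) \<and> (2 * M + 3) dvd e}"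
  proof (cases "prime (2 * M + 3) \<and> (2 * M + 3) dvd e")
    case False
    have "p \<le> 2 * M + 1" if p: "prime p" "p dvd e" for p
    proof -
      have "p \<le> 2 * M + 3" using e p by (auto simp: smooth_odd_def)
      moreover have "p \<noteq> 2 * M + 3" using False p by auto
      moreover have "odd p" using e p(2) by (auto simp: smooth_odd_def)
      then have "p \<noteq> 2 * M + 2" by auto
      ultimately show ?thesis by linarith
    qed
    then show ?thesis using e by (auto simp: smooth_odd_def)
  qed (use e in auto)
qed

text \<open>Cancelling one factor p from e stays inside \<open>smooth_odd Y q\<close>. Bounding by
  the same sum, multiples of p included, replaces a geometric series over powers of p.\<close>

lemma sum_wt_multiples_le:
  assumes "prime p"
  shows "(\<Sum>e\<in>{e \<in> smooth_odd Y q. p dvd e}. wt e) \<le> wt p * (\<Sum>e\<in>smooth_odd Y q. wt e)"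
proof -
  have p: "p \<ge> 2" using assms prime_ge_2_nat by blast
  have sub: "{e \<in> smooth_odd Y q. p dvd e} \<subseteq> (\<lambda>f. p * f) ` smooth_odd Y q"
  proof
    fix e assume e: "e \<in> {e \<in> smooth_odd Y q. p dvd e}"
    then obtain f where f: "e = p * f" by auto
    have "f \<noteq> 0" using e f by (auto simp: smooth_odd_def)
    moreover have "f \<le> p * f" using p by simp
    moreover have "p * f \<le> Y" using e f by (simp add: smooth_odd_def)
    ultimately have "f \<le> Y" "f \<noteq> 0" by linarith+
    then have "f \<in> smooth_odd Y q" using e f by (auto simp: smooth_odd_def)
    then show "e \<in> (\<lambda>f. p * f) ` smooth_odd Y q" using f by auto
  qed
  have "(\<Sum>e\<in>{e \<in> smooth_odd Y q. p dvd e}. wt e) \<le> (\<Sum>e\<in>(\<lambda>f. p * f) ` smooth_odd Y q. wt e)"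
    by (intro sum_mono2 sub) (auto simp: wt_nonneg)
  also have "\<dots> \<le> (\<Sum>f\<in>smooth_odd Y q. wt (p * f))"
    using sum_image_le[of "smooth_odd Y q" wt "\<lambda>f. p * f"] by (simp add: wt_nonneg)
  also have "\<dots> = wt p * (\<Sum>e\<in>smooth_odd Y q. wt e)"
    unfolding sum_distrib_left
    by (intro sum.cong refl wt_mult) (use p in \<open>auto simp: smooth_odd_def\<close>)
  finally show ?thesis .
qed

text \<open>The right side is the product of q^2/((q-2)(q+2)) over odd q from 3 to 2M+1: the factors
  q/(q-2) telescope to 2M+1 and the factors q/(q+2) to 3/(2M+3).\<close>

lemma sum_wt_smooth_odd_le:
  "(\<Sum>e\<in>smooth_odd Y (2 * M + 1). wt e) \<le> 3 * (2 * real M + 1) / (2 * real M + 3)"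
proof (induction M)
  case 0
  have "smooth_odd Y 1 \<subseteq> {1}"
  proof
    fix e assume e: "e \<in> smooth_odd Y 1"
    have "\<not> p dvd e" if "prime p" for p
      using e that prime_gt_1_nat[OF that] unfolding smooth_odd_def by (metis (lifting) leD mem_Collect_eq)
    then show "e \<in> {1}" using prime_factor_nat[of e] by blast
  qed
  then have "(\<Sum>e\<in>smooth_odd Y 1. wt e) \<le> (\<Sum>e\<in>{1}. wt e)"
    by (intro sum_mono2) (auto simp: wt_nonneg)
  then show ?case by (simp add: wt_def)
next
  case (Suc M)
  define p where "p = 2 * M + 3"
  define S where "S = (\<Sum>e\<in>smooth_odd Y p. wt e)"
  define T where "T = (\<Sum>e\<in>smooth_odd Y (2 * M + 1). wt e)"
  have S0: "S \<ge> 0" by (simp add: S_def sum_nonneg wt_nonneg)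
  have "S \<le> T + (\<Sum>e\<in>{e \<in> smooth_odd Y p. prime p \<and> p dvd e}. wt e)"
  proof -
    have "S \<le> (\<Sum>e\<in>smooth_odd Y (2*M+1) \<union> {e \<in> smooth_odd Y p. prime p \<and> p dvd e}. wt e)"
      unfolding S_def p_def by (intro sum_mono2 smooth_odd_step) (auto simp: wt_nonneg)
    also have "\<dots> \<le> T + (\<Sum>e\<in>{e \<in> smooth_odd Y p. prime p \<and> p dvd e}. wt e)"
      unfolding T_def by (subst sum.union_inter [symmetric]) (auto simp: wt_nonneg sum_nonneg)
    finally show ?thesis .
  qed
  \<comment> \<open>For composite p the left sum is empty, so p may be treated as if it were
    prime.\<close>
  also have "(\<Sum>e\<in>{e \<in> smooth_odd Y p. prime p \<and> p dvd e}. wt e) \<le> 4 / real p ^ 2 * S"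
  proof (cases "prime p")
    case True
    then show ?thesis using sum_wt_multiples_le[OF True, of Y p] by (simp add: S_def wt_def)
  qed (simp add: S0)
  \<comment> \<open>S bounds itself; collecting it on the left yields the Euler factor 1/(1 - 4/p^2)
    = p^2/((p-2)(p+2)).\<close>
  finally have "S * (1 - 4 / real p ^ 2) \<le> T" by (simp add: algebra_simps)
  also have "T \<le> 3 * (real p - 2) / real p" using Suc by (simp add: T_def p_def add.commute)
  finally have "real p ^ 2 * (S * (1 - 4 / real p ^ 2)) \<le> real p ^ 2 * (3 * (real p - 2) / real p)"
    by (intro mult_left_mono) auto
  moreover have p3: "real p \<ge> 3" by (simp add: p_def)
  moreover have "real p ^ 2 * (S * (1 - 4 / real p ^ 2)) = S * ((real p - 2) * (real p + 2))"
    using p3 by (simp add: field_simps power2_eq_square)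
  moreover have "real p ^ 2 * (3 * (real p - 2) / real p) = 3 * (real p - 2) * real p"
    using p3 by (simp add: power2_eq_square)
  ultimately have "S * ((real p - 2) * (real p + 2)) \<le> 3 * (real p - 2) * real p"
    by simp
  then have "(real p - 2) * (S * (real p + 2)) \<le> (real p - 2) * (3 * real p)"
    by (simp add: algebra_simps)
  then have "S * (real p + 2) \<le> 3 * real p" using p3 by (simp add: mult_le_cancel_left)
  then have "S \<le> 3 * real p / (real p + 2)" using p3 by (simp add: field_simps)
  moreover have "2 * Suc M + 1 = p" by (simp add: p_def)
  moreover have "2 * real (Suc M) + 1 = real p" "2 * real (Suc M) + 3 = real p + 2"
    by (simp_all add: p_def)
  ultimately show ?case by (simp only: S_def)
qed

lemma sum_wt_odd_le: "(\<Sum>e\<in>{e\<in>{1..Y}. odd e}. wt e) \<le> 3"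
proof -
  \<comment> \<open>No divisor of a number in {1..Y} exceeds Y, so smoothness is automatic
    here.\<close>
  have "{e\<in>{1..Y}. odd e} = smooth_odd Y (2 * Y + 1)"
  proof -
    have "p \<le> 2 * Y + 1" if "e \<in> {1..Y}" "p dvd e" for e p
      using that dvd_imp_le[of p e] by simp
    then show ?thesis unfolding smooth_odd_def by blast
  qed
  then have "(\<Sum>e\<in>{e\<in>{1..Y}. odd e}. wt e) \<le> 3 * (2 * real Y + 1) / (2 * real Y + 3)"
    using sum_wt_smooth_odd_le[of Y Y] by simp
  also have "\<dots> \<le> 3" by (simp add: field_simps)
  finally show ?thesis .
qed

section \<open>From weighted sums to counting integers with prescribed
  \<open>big_omega\<close>\<close>

lemma sum_two_power_big_omega_odd_le:
  assumes "n \<le> M"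
  shows "(\<Sum>m\<in>{m\<in>{1..n}. odd m}. 2 ^ big_omega m) \<le> 3 * real n * harm M"
proof -
  define E where "E = {e\<in>{1..n}. odd e}"
  define R where "R e = {s\<in>{1..n div e\<^sup>2}. squarefree s}" for e
  define h :: "nat \<times> nat \<Rightarrow> nat" where "h = (\<lambda>(e, s). e\<^sup>2 * s)"
  let ?w = "\<lambda>m. 2 ^ big_omega m :: real"
  have fin: "finite (Sigma E R)" by (auto simp: E_def R_def)
  \<comment> \<open>As all weights are nonnegative, covering the odd m by pairs (e, s) suffices for
    an upper bound.\<close>
  have sub: "{m\<in>{1..n}. odd m} \<subseteq> h ` Sigma E R"
  proof
    fix m assume m: "m \<in> {m\<in>{1..n}. odd m}"
    define e s where "e = square_part m" and "s = squarefree_part m"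
    have ms: "m = e\<^sup>2 * s" by (simp add: e_def s_def squarefree_decompose mult.commute)
    have sq: "squarefree s" using m by (simp add: s_def)
    have pos: "e > 0" "s > 0" using m ms by (auto intro!: gr0I)
    have "e \<le> e\<^sup>2 * s" using pos by (simp add: power2_eq_square)
    then have "e \<le> n" using m ms by auto
    moreover have "odd e" using m ms by auto
    moreover have "s \<le> n div e\<^sup>2" using m ms pos
      by (simp add: less_eq_div_iff_mult_less_eq mult.commute)
    ultimately have "(e, s) \<in> Sigma E R" using pos sq by (auto simp: E_def R_def)
    then show "m \<in> h ` Sigma E R" using ms by (force simp: h_def)
  qed
  have "(\<Sum>m\<in>{m\<in>{1..n}. odd m}. ?w m) \<le> (\<Sum>m\<in>h ` Sigma E R. ?w m)"
    by (intro sum_mono2 sub) (auto simp: fin)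
  also have "\<dots> \<le> (\<Sum>x\<in>Sigma E R. ?w (h x))"
    using sum_image_le[OF fin, of ?w h] by simp
  also have "\<dots> = (\<Sum>e\<in>E. \<Sum>s\<in>R e. ?w (e\<^sup>2 * s))"
    by (subst sum.Sigma) (auto simp: E_def R_def h_def split_def)
  also have "\<dots> \<le> (\<Sum>e\<in>E. wt e * (real n * harm M))"
  proof (rule sum_mono)
    fix e assume "e \<in> E"
    then have e: "e \<noteq> 0" by (auto simp: E_def)
    have "(\<Sum>s\<in>R e. ?w (e\<^sup>2 * s)) = (\<Sum>s\<in>R e. 4 ^ big_omega e * ?w s)"
      using e by (intro sum.cong)
        (auto simp: R_def big_omega_mult big_omega_power power_add power_mult)
    also have "\<dots> \<le> (\<Sum>s\<in>R e. 4 ^ big_omega e * real (card {d. d dvd s}))"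
    proof (intro sum_mono mult_left_mono)
      fix s assume "s \<in> R e"
      then have "2 ^ big_omega s \<le> card {d. d dvd s}"
        by (intro two_power_big_omega_le_card_divisors) (simp add: R_def)
      then show "?w s \<le> real (card {d. d dvd s})"
        by (metis of_nat_le_iff of_nat_numeral of_nat_power)
    qed auto
    also have "\<dots> \<le> (\<Sum>s=1..n div e\<^sup>2. 4 ^ big_omega e * real (card {d. d dvd s}))"
      by (intro sum_mono2) (auto simp: R_def)
    also have "\<dots> = 4 ^ big_omega e * (\<Sum>s=1..n div e\<^sup>2. real (card {d. d dvd s}))"
      by (simp add: sum_distrib_left)
    also have "\<dots> \<le> 4 ^ big_omega e * (real (n div e\<^sup>2) * harm M)"
      using order_trans[OF div_le_dividend assms]
      by (intro mult_left_mono sum_card_divisors_le) auto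
    also have "\<dots> \<le> 4 ^ big_omega e * (real n / real (e\<^sup>2) * harm M)"
      by (intro mult_left_mono mult_right_mono of_nat_div_le_of_nat harm_nonneg) auto
    finally show "(\<Sum>s\<in>R e. ?w (e\<^sup>2 * s)) \<le> wt e * (real n * harm M)"
      by (simp add: wt_def)
  qed
  also have "\<dots> = (\<Sum>e\<in>E. wt e) * (real n * harm M)"
    by (simp add: sum_distrib_right)
  also have "\<dots> \<le> 3 * (real n * harm M)"
    unfolding E_def by (intro mult_right_mono sum_wt_odd_le) (auto simp: harm_nonneg)
  finally show ?thesis by simp
qed

text \<open>Rankin's trick: every counted m has weight exactly \<open>2 ^ j\<close>, and the
  remaining odd m only enlarge the weighted sum.\<close>

lemma card_big_omega_odd_le:
  assumes "n \<le> M"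
  shows "2 ^ j * real (card {m\<in>{1..n}. odd m \<and> big_omega m = j}) \<le> 3 * real n * harm M"
proof -
  have "2 ^ j * real (card {m\<in>{1..n}. odd m \<and> big_omega m = j})
      = (\<Sum>m\<in>{m\<in>{1..n}. odd m \<and> big_omega m = j}. 2 ^ big_omega m)"
    by simp
  also have "\<dots> \<le> (\<Sum>m\<in>{m\<in>{1..n}. odd m}. 2 ^ big_omega m)"
    by (intro sum_mono2) auto
  also have "\<dots> \<le> 3 * real n * harm M"
    by (rule sum_two_power_big_omega_odd_le[OF assms])
  finally show ?thesis .
qed

text \<open>Split by the power of 2 dividing m. The exponent a takes k+1 values, and each
  contributes the same bound, since the factor \<open>2 ^ a\<close> left over from
  \<open>2 ^ k\<close> cancels the shortened range.\<close>

lemma card_big_omega_le: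
  "2 ^ k * real (card {m\<in>{1..n}. big_omega m = k}) \<le> 3 * (real k + 1) * real n * harm n"
proof -
  define A where "A a = {m\<in>{1..n div 2 ^ a}. odd m \<and> big_omega m = k - a}" for a
  have sub: "{m\<in>{1..n}. big_omega m = k} \<subseteq> (\<Union>a\<in>{..k}. (\<lambda>m. 2 ^ a * m) ` A a)"
  proof
    fix m assume m: "m \<in> {m\<in>{1..n}. big_omega m = k}"
    then have "m \<noteq> 0" by auto
    then obtain l where l: "m = 2 ^ multiplicity 2 m * l" "odd l"
      using multiplicity_decompose'[of m 2] by auto
    define a where "a = multiplicity 2 m"
    have ml: "m = 2 ^ a * l" using l by (simp add: a_def)
    have l0: "l \<noteq> 0" using l(2) by (auto intro!: Nat.gr0I)
    have "k = a + big_omega l" using m l0 unfolding ml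
      by (simp add: big_omega_mult big_omega_power)
    moreover have "l \<le> n div 2 ^ a" using m ml
      by (simp add: less_eq_div_iff_mult_less_eq mult.commute)
    ultimately have "l \<in> A a" "a \<le> k" using l0 l(2) by (auto simp: A_def)
    then show "m \<in> (\<Union>a\<in>{..k}. (\<lambda>m. 2 ^ a * m) ` A a)"
      using ml by auto
  qed
  have finA: "finite (A a)" for a by (simp add: A_def)
  have "card {m\<in>{1..n}. big_omega m = k} \<le> card (\<Union>a\<in>{..k}. (\<lambda>m. 2 ^ a * m) ` A a)"
    by (intro card_mono sub) (auto simp: finA)
  also have "\<dots> \<le> (\<Sum>a\<le>k. card ((\<lambda>m. 2 ^ a * m) ` A a))"
    by (rule card_UN_le) simp
  also have "\<dots> \<le> (\<Sum>a\<le>k. card (A a))"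
    by (intro sum_mono card_image_le finA)
  finally have "real (card {m\<in>{1..n}. big_omega m = k}) \<le> (\<Sum>a\<le>k. real (card (A a)))"
    by (metis of_nat_le_iff of_nat_sum)
  then have "2 ^ k * real (card {m\<in>{1..n}. big_omega m = k}) \<le> (\<Sum>a\<le>k. 2 ^ k * real (card (A a)))"
    by (simp add: sum_distrib_left[symmetric])
  also have "\<dots> \<le> (\<Sum>a\<le>k. 3 * real n * harm n)"
  proof (rule sum_mono)
    fix a assume "a \<in> {..k}"
    \<comment> \<open>Here a \<le> k ensures that the natural subtraction is not truncated.\<close>
    then have "2 ^ k * real (card (A a)) = 2 ^ a * (2 ^ (k - a) * real (card (A a)))"
      by (simp flip: power_add mult.assoc)
    also have "\<dots> \<le> 2 ^ a * (3 * real (n div 2 ^ a) * harm n)"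
      unfolding A_def by (intro mult_left_mono card_big_omega_odd_le) auto
    also have "\<dots> \<le> 2 ^ a * (3 * (real n / real (2 ^ a)) * harm n)"
      by (intro mult_left_mono mult_right_mono of_nat_div_le_of_nat harm_nonneg) auto
    finally show "2 ^ k * real (card (A a)) \<le> 3 * real n * harm n" by simp
  qed
  also have "\<dots> = 3 * (real k + 1) * real n * harm n" by (simp add: algebra_simps)
  finally show ?thesis .
qed

text \<open>Every prime is 2 or an odd number at least 3. This crude bound serves the case k =
  1.\<close>

lemma card_primes_le: "2 * card {p\<in>{1..n}. prime p} \<le> n + 1"
proof -
  have "{p\<in>{1..n}. prime p} \<subseteq> insert 2 ((\<lambda>j. 2 * j + 1) ` {1..(n - 1) div 2})"
  proof
    fix p assume p: "p \<in> {p\<in>{1..n}. prime p}"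
    show "p \<in> insert 2 ((\<lambda>j. 2 * j + 1) ` {1..(n - 1) div 2})"
    proof (cases "p = 2")
      case False
      then have "odd p" "p > 2" using p prime_odd_nat[of p] prime_ge_2_nat[of p] by auto
      then obtain j where j: "p = 2 * j + 1" by (auto elim: oddE)
      then have "j \<in> {1..(n - 1) div 2}" using p \<open>p > 2\<close> by auto
      then show ?thesis using j by auto
    qed simp
  qed
  then have "card {p\<in>{1..n}. prime p} \<le> card (insert 2 ((\<lambda>j. 2 * j + 1) ` {1..(n - 1) div 2}))"
    by (rule card_mono[rotated]) simp
  also have "\<dots> \<le> Suc (card ((\<lambda>j. 2 * j + 1) ` {1..(n - 1) div 2}))"
    by (rule card_insert_le_m1) auto
  also have "\<dots> \<le> Suc ((n - 1) div 2)"
    using card_image_le[of "{1..(n - 1) div 2}" "\<lambda>j. 2 * j + 1"] by simp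
  finally have le: "card {p\<in>{1..n}. prime p} \<le> Suc ((n - 1) div 2)" .
  show ?thesis
  \<comment> \<open>At n = 0 truncated subtraction makes \<open>le\<close> give only the bound 1, so
    this case is separate.\<close>
  proof (cases "n = 0")
    case False
    then show ?thesis using le by linarith
  qed simp
qed

section \<open>Assembly of the bound, with k = 1 and k = 2 treated directly\<close>

theorem theorem8:
  fixes x :: real and k :: nat
  assumes "x \<ge> 3" and "k \<ge> 1"
  shows "real (N k x) \<le> 1.35 * real k ^ 3 * (x * ln x / 2 ^ k)"
proof -
  define n where "n = nat \<lfloor>x\<rfloor>"
  have nx: "real n \<le> x" using assms(1) by (simp add: n_def)
  have n3: "n \<ge> 3" using assms(1) by (simp add: n_def le_nat_iff le_floor_iff)
  have N_eq: "N k x = card {m\<in>{1..n}. big_omega m = k}"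
    unfolding N_def n_def using assms(1)
    by (intro arg_cong[where f = card]) (auto simp: le_nat_iff le_floor_iff)
  \<comment> \<open>Uses e \<le> 3 \<le> x.\<close>
  have ln1: "ln x \<ge> 1"
    using assms(1) exp_le by (subst ln_ge_iff) linarith+
  have xln: "x \<le> x * ln x" using ln1 assms(1) by simp
  consider "k = 1" | "k = 2" | "k \<ge> 3" using assms(2) by linarith
  then show ?thesis
  proof cases
    case 1
    have "{m\<in>{1..n}. big_omega m = k} \<subseteq> {p\<in>{1..n}. prime p}"
      using 1 big_omega_eq_1_imp_prime by auto
    then have "N k x \<le> card {p\<in>{1..n}. prime p}"
      unfolding N_eq by (intro card_mono) auto
    then have "2 * N k x \<le> n + 1" using card_primes_le[of n] by linarith
    then have "2 * real (N k x) \<le> real n + 1" by linarith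
    \<comment> \<open>27/40 is 1.35/2, and (n+1)/2 \<le> 27n/40 holds once n \<ge> 20/7.\<close>
    then have "real (N k x) \<le> 27 / 40 * x" using n3 nx by linarith
    also have "\<dots> \<le> 27 / 40 * (x * ln x)" using xln by simp
    finally show ?thesis using 1 by simp
  next
    case 2
    \<comment> \<open>Counting all integers is enough: for k = 2 the target constant is 1.35 * 8/4 =
      2.7.\<close>
    have "N k x \<le> card {1..n}" unfolding N_eq by (intro card_mono) auto
    then have "real (N k x) \<le> x" using nx by simp
    then have "real (N k x) \<le> 27 / 10 * (x * ln x)" using xln assms(1) by linarith
    then show ?thesis using 2 by simp
  next
    case 3
    have "harm n \<le> 2 * ln x"
    proof -
      have "harm n \<le> ln (real n) + 1" using n3 by (intro harm_le_ln_plus_1) simp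
      also have "ln (real n) \<le> ln x" using nx n3 by simp
      finally show ?thesis using ln1 by linarith
    qed
    then have hx: "real n * harm n \<le> x * (2 * ln x)"
      using nx by (intro mult_mono) (auto simp: harm_nonneg)
    \<comment> \<open>The 6 is the 3 of the odd sum times the 2 of
      \<open>harm n \<le> 2 * ln x\<close>. The inequality fails at k = 2; for k \<ge> 3 it follows
      from k^3 \<ge> 9k.\<close>
    have kk: "6 * (real k + 1) \<le> 27 / 20 * real k ^ 3"
    proof -
      have "9 * real k \<le> real k ^ 2 * real k"
        using 3 power_mono[of 3 "real k" 2] by (intro mult_right_mono) auto
      then have "9 * real k \<le> real k ^ 3" by (simp add: power3_eq_cube power2_eq_square)
      moreover have "real k \<ge> 3" using 3 by simp
      ultimately show ?thesis
        unfolding distrib_left by argo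
    qed
    have "2 ^ k * real (N k x) \<le> 3 * (real k + 1) * (real n * harm n)"
      using card_big_omega_le[of k n] unfolding N_eq by (simp add: mult.assoc)
    also have "\<dots> \<le> 3 * (real k + 1) * (x * (2 * ln x))"
      by (intro mult_left_mono hx) auto
    also have "\<dots> = 6 * (real k + 1) * (x * ln x)" by simp
    also have "\<dots> \<le> 27 / 20 * real k ^ 3 * (x * ln x)"
      using assms(1) xln by (intro mult_right_mono kk) linarith
    finally show ?thesis by (simp add: field_simps)
  qed
qed

end
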